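(* Let $I$ be a finite set of $n$ non-negative integers with $0\in I$ and with the greatest common divisor of the elements of $I$ equal to $1$, and let $V=\langle x^{i}\mid i\in I\rangle\subset\mathbb{C}[x]$. For $m\in\mathbb{Z}$ put $I^{(m)}=\{i\in I\mid i+m\ge0 \text{ and } i+m\notin I\}$. Let $\mathcal{D}_V$ be the algebra of finite-order linear differential operators with polynomial coefficients that map $V$ into $V$. Let $T_2\in\mathcal{D}_V$ be a second-order operator, written $T_2=\sum_mT^{(m)}$ with $T^{(m)}$ of degree $m$ and order less than or equal to $2$. If $T^{(m)}\neq0$, then $I^{(m)}$ contains $0$, $1$ or $2$ elements. Moreover, the following holds. (1) If for all $m>0$ the set $I^{(m)}$ contains more than $2$ elements, then $T_2$ contains no terms of positive degree, and hence $T_2$ preserves $\langle 1,x,x^2,\dots,x^{N}\rangle$ for all $N$. (2) $I^{(m)}$ can be empty only if $m=0$. All operators of degree $0$ are in $\mathcal{D}_V$; hence degree $0$ contributes to $T_2$ the operator $\alpha_1x^2\partial^2+\alpha_2x\partial+\alpha_3$ ($\alpha_i\in\mathbb{C}$), which is always present in the most general $T_2$. (3) If $I^{(m)}$ contains one element, then $m=1$ and $V=\langle 1,x,x^2,\dots,x^{n-1}\rangle$. (4) Suppose that $I^{(m)}$ contains $2$ elements, where $m>0$, and that no $I^{(l)}$ with $l>0$ contains one element. Let $i_1>i_2$ be the two elements of $I^{(m)}$. Then $I$ consists of two chains with step $m$, of lengths $r$ and $s$: $$I=\{i_1,i_3,\dots,i_{2r-1}\}\cup\{i_2,i_4,\dots,i_{2s}\},$$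 $$i_3=i_1-m,\ i_5=i_3-m,\ \dots,\ i_{2r-1}=i_{2r-3}-m,\qquad i_4=i_2-m,\ i_6=i_4-m,\ \dots,\ i_{2s}=i_{2s-2}-m.$$ If moreover $I$ can be split into two chains in exactly one way, then the most general second-order operator in $\mathcal{D}_V$ is $$T_2=\alpha_1x^m(x\partial-i_1)(x\partial-i_2)+\alpha_2x^2\partial^2+\alpha_3x\partial+\alpha_4,\qquad \alpha_i\in\mathbb{C},$$ except that $T_2$ contains an extra term in two cases: (a) if $m=1$ (and therefore $i_{2s}=0$), there is an extra term $\alpha_5\,\partial(x\partial-i_{2r-1})$; (b) if $m=2$ and $\{i_{2s},i_{2r-1}\}=\{0,1\}$, there is an extra term $\alpha_5\,\partial^2$.
   Context: $\partial=d/dx$, and $\langle\cdot\rangle$ denotes complex linear span. Differential operators are of the form $\sum_iP_i\partial^i$ with $P_i\in\mathbb{C}[x]$, acting on $\mathbb{C}[x]$. An operator $T$ has degree $m$ if $T(x^i)\in\langle x^{i+m}\rangle$ for all $i$. A chain with step $m$ is a finite set of the form $\{a,a-m,a-2m,\dots,a-(r-1)m\}$, and $r\ge1$ is its length. A splitting of $I$ into two chains means writing $I$ as a disjoint union of two chains with a common step.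
   Formalization: The claim in (2) that I^(m) is empty only if m=0, and claim (3), are stated for m≥0 only; for negative m they fail: I^(m) is empty for every m<-max I, and I={0,1,3} has I^(-1)={3}. *)

theory Defs
  imports "HOL-Computational_Algebra.Polynomial"
begin

global_interpretation cpoly: vector_space "smult :: complex \<Rightarrow> complex poly \<Rightarrow> complex poly"
  by unfold_locales (simp_all add: smult_add_right smult_add_left)

definition monomial_space :: "nat set \<Rightarrow> complex poly set" where
  "monomial_space I = cpoly.span ((\<lambda>i. monom 1 i) ` I)"

(* A differential operator is identified with the map that it induces on polynomials;
   in characteristic 0 its coefficients are determined by this map. *)
type_synonym poly_operator = "complex poly \<Rightarrow> complex poly"

definition diffop_order_le :: "nat \<Rightarrow> poly_operator \<Rightarrow> bool" where
  "diffop_order_le k T \<longleftrightarrow>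
     (\<exists>P :: nat \<Rightarrow> complex poly. T = (\<lambda>f. \<Sum>i\<le>k. P i * (pderiv ^^ i) f))"

definition diffop :: "poly_operator \<Rightarrow> bool" where
  "diffop T \<longleftrightarrow> (\<exists>k. diffop_order_le k T)"

(* If i + m < 0, the spanning set is empty, so the condition reads T (x^i) = 0. *)
definition has_degree :: "poly_operator \<Rightarrow> int \<Rightarrow> bool" where
  "has_degree T m \<longleftrightarrow>
     (\<forall>i::nat. T (monom 1 i) \<in> cpoly.span {monom 1 k | k::nat. int k = int i + m})"

definition diffops_preserving :: "complex poly set \<Rightarrow> poly_operator set" where
  "diffops_preserving V = {T. diffop T \<and> T ` V \<subseteq> V}"

definition second_order_ops_preserving :: "complex poly set \<Rightarrow> poly_operator set" where
  "second_order_ops_preserving V = {T \<in> diffops_preserving V. diffop_order_le 2 T}"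

definition homogeneous_decomposition :: "poly_operator \<Rightarrow> (int \<Rightarrow> poly_operator) \<Rightarrow> bool" where
  "homogeneous_decomposition T Tc \<longleftrightarrow>
     finite {m. Tc m \<noteq> (\<lambda>_. 0)} \<and>
     (\<forall>m. diffop_order_le 2 (Tc m) \<and> has_degree (Tc m) m) \<and>
     T = (\<lambda>f. \<Sum>m | Tc m \<noteq> (\<lambda>_. 0). Tc m f)"

(* The set I^(m). Indices with i + m < 0 are left out, so for m < 0 this set can be empty
   (I = {0,1}, m = -1) or a singleton (I = {0,1,3}, m = -1). *)
definition exits :: "nat set \<Rightarrow> int \<Rightarrow> nat set" where
  "exits I m = {i \<in> I. int i + m \<ge> 0 \<and> int i + m \<notin> int ` I}"

(* chain m a r = {a, a - m, ..., a - (r - 1) m}; the truncated subtraction is harmless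
   as long as (r - 1) m \<le> a, which is required wherever chains are used. *)
definition chain :: "nat \<Rightarrow> nat \<Rightarrow> nat \<Rightarrow> nat set" where
  "chain m a r = {a - k * m | k. k < r}"

definition is_chain :: "nat \<Rightarrow> nat set \<Rightarrow> bool" where
  "is_chain m A \<longleftrightarrow> (\<exists>a r. r \<ge> 1 \<and> (r - 1) * m \<le> a \<and> A = chain m a r)"

(* A splitting is the unordered pair of its chains. When I has more than two elements,
   one chain has at least two elements, so the pair determines the step. *)
definition splittings :: "nat set \<Rightarrow> nat set set set" where
  "splittings I = {{A, B} | A B. A \<inter> B = {} \<and> A \<union> B = I \<and>
                                 (\<exists>m>0. is_chain m A \<and> is_chain m B)}"

(* The operator x \<partial> - c. *)
definition xD_minus :: "nat \<Rightarrow> poly_operator" where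
  "xD_minus c f = monom 1 1 * pderiv f - smult (of_nat c) f"

(* a x^2 \<partial>^2 + b x \<partial> + c *)
definition degree0_op :: "complex \<Rightarrow> complex \<Rightarrow> complex \<Rightarrow> poly_operator" where
  "degree0_op a b c f =
     smult a (monom 1 2 * pderiv (pderiv f)) + smult b (monom 1 1 * pderiv f) + smult c f"

end

(* A second-order operator acts by x^i |-> sum_m q_m(i) x^(i+m) with q_m a polynomial of degree
   at most 2, so it preserves V iff each q_m vanishes on I^(m); three zeros force q_m = 0.
   For m > 0, I is the disjoint union of the maximal chains of step m, whose tops are the elements
   of I^(m) and whose bottoms lie in {0..<m} or in I^(-m). As q_(-m) vanishes on {0..<m} and on
   I^(-m), either of q_m, q_(-m) being nonzero leaves at most two chains of step m. If I splits
   into two chains in only one way, this fixes m, and the two tops and the two bottoms are the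
   zeros of q_m and q_(-m). *)

theory Submission
  imports Defs
begin

subsection \<open>Symbols of operators\<close>

text \<open>The obstacle is negative degree: I^(-m) alone may be too small to bound q_(-m). The
  further zeros are 0, ..., m-1, where the power x^(i-m) does not exist; the quadratic formula for
  the symbol is proved to vanish there as well, so they are genuine zeros. Sending each top to its
  bottom then bounds the number of tops by the number of zeros, so that I^(m) controls both signs of
  the degree. A step l with at most two tops has exactly two: none is impossible because climbing
  from 0 must leave a finite set, and one is excluded by hypothesis. It yields a splitting, hence
  the same pair of chains as for m. Equal pairs need not have equal steps, since two singletons are
  chains of every step; |I| >= 3 supplies a chain with two elements, and such a chain determines its
  step. The extra terms record when q_(-m) has only two forced zeros: {0..<m} together with two
  distinct bottoms has at least m elements, so m is 1 or 2. For m = 1 one bottom is 0; for m = 2 the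
  bottoms must be 0 and 1.\<close>

abbreviation poly_linear :: "poly_operator \<Rightarrow> bool" where
  "poly_linear T \<equiv> Vector_Spaces.linear smult smult T"

lemma poly_linearI:
  assumes "\<And>f g. T (f + g) = T f + T g" and "\<And>c f. T (smult c f) = smult c (T f)"
  shows "poly_linear T"
  unfolding Vector_Spaces.linear_iff using assms cpoly.vector_space_axioms by auto

lemma poly_linear_add: "poly_linear T \<Longrightarrow> T (f + g) = T f + T g"
  and poly_linear_smult: "poly_linear T \<Longrightarrow> T (smult c f) = smult c (T f)"
  by (auto simp: Vector_Spaces.linear_iff)

lemma poly_linear_0: "poly_linear T \<Longrightarrow> T 0 = 0"
  using poly_linear_smult[of T 0 0] by simp

lemma poly_linear_sum: "poly_linear T \<Longrightarrow> T (sum f A) = (\<Sum>a\<in>A. T (f a))"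
  by (induction A rule: infinite_finite_induct) (auto simp: poly_linear_0 poly_linear_add)

lemma poly_linear_expand:
  assumes "poly_linear T"
  shows "T f = (\<Sum>i\<le>degree f. smult (coeff f i) (T (monom 1 i)))"
proof -
  have "T f = T (\<Sum>i\<le>degree f. smult (coeff f i) (monom 1 i))"
    by (simp add: smult_monom poly_as_sum_of_monoms)
  also have "\<dots> = (\<Sum>i\<le>degree f. smult (coeff f i) (T (monom 1 i)))"
    using assms by (simp add: poly_linear_sum poly_linear_smult)
  finally show ?thesis .
qed

lemma poly_linear_sum_operators:
  assumes "\<And>a. a \<in> A \<Longrightarrow> poly_linear (T a)"
  shows "poly_linear (\<lambda>f. \<Sum>a\<in>A. T a f)"
proof (rule poly_linearI)
  show "(\<Sum>a\<in>A. T a (f + g)) = (\<Sum>a\<in>A. T a f) + (\<Sum>a\<in>A. T a g)" for f g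
    by (simp add: assms poly_linear_add sum.distrib)
  have smult_sum: "smult c (sum h A) = (\<Sum>a\<in>A. smult c (h a))" for c and h :: "_ \<Rightarrow> complex poly"
    by (induction A rule: infinite_finite_induct) (auto simp: smult_add_right)
  show "(\<Sum>a\<in>A. T a (smult c f)) = smult c (\<Sum>a\<in>A. T a f)" for c f
    by (simp add: assms poly_linear_smult smult_sum)
qed

lemma funpow_pderiv_linear: "poly_linear (pderiv ^^ k)"
  by (rule poly_linearI; induction k) (auto simp: pderiv_add pderiv_smult)

lemma diffop_order_le_linear:
  assumes "diffop_order_le k T"
  shows "poly_linear T"
proof -
  obtain P where T: "T = (\<lambda>f. \<Sum>i\<le>k. P i * (pderiv ^^ i) f)"
    using assms by (auto simp: diffop_order_le_def)
  show ?thesis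
    unfolding T by (rule poly_linear_sum_operators, rule poly_linearI)
      (simp_all add: poly_linear_add[OF funpow_pderiv_linear]
         poly_linear_smult[OF funpow_pderiv_linear] algebra_simps)
qed

lemma diffop_linear: "diffop T \<Longrightarrow> poly_linear T"
  by (auto simp: diffop_def diffop_order_le_linear)

text \<open>The coefficient \<open>q\<^sub>m(i)\<close> of \<open>x\<^sup>i\<^sup>+\<^sup>m\<close> in \<open>T x\<^sup>i\<close>; its value \<open>0\<close> for \<open>i + m < 0\<close> is no
  junk convention: for an operator of order at most 2 it agrees with the quadratic polynomial.\<close>

definition opsym :: "poly_operator \<Rightarrow> int \<Rightarrow> nat \<Rightarrow> complex" where
  "opsym T m i = (if int i + m \<ge> 0 then coeff (T (monom 1 i)) (nat (int i + m)) else 0)"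

lemma coeff_eq_opsym: "coeff (T (monom 1 i)) j = opsym T (int j - int i) i"
  by (simp add: opsym_def)

lemma opsym_add: "opsym (\<lambda>f. T f + S f) m i = opsym T m i + opsym S m i"
  and opsym_smult: "opsym (\<lambda>f. smult c (T f)) m i = c * opsym T m i"
  and opsym_zero: "opsym (\<lambda>f. 0) m i = 0"
  and opsym_sum: "opsym (\<lambda>f. \<Sum>a\<in>A. Tf a f) m i = (\<Sum>a\<in>A. opsym (Tf a) m i)"
  by (simp_all add: opsym_def coeff_sum)

lemma opsym_below: "int i + m < 0 \<Longrightarrow> opsym T m i = 0"
  by (simp add: opsym_def)

text \<open>Every coefficient of T x^i is a value of the symbol, and monomials determine a linear
  map. The operator identities below are mostly reduced to this comparison of symbols.\<close>

lemma poly_linear_eqI: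
  assumes "poly_linear T" "poly_linear S" "\<And>m i. opsym T m i = opsym S m i"
  shows "T = S"
proof
  fix f
  have "T (monom 1 i) = S (monom 1 i)" for i
    by (rule poly_eqI) (simp add: coeff_eq_opsym assms)
  then show "T f = S f"
    by (subst (1 2) poly_linear_expand) (simp_all add: assms)
qed

lemma mem_monomial_space: "f \<in> monomial_space I \<longleftrightarrow> (\<forall>j. coeff f j \<noteq> 0 \<longrightarrow> j \<in> I)"
proof
  assume "f \<in> monomial_space I"
  then show "\<forall>j. coeff f j \<noteq> 0 \<longrightarrow> j \<in> I"
    unfolding monomial_space_def
  proof (induction rule: cpoly.span_induct_alt)
    case base
    then show ?case by simp
  next
    case (step c x y)
    then show ?case by (auto split: if_splits)
  qed
next
  assume f: "\<forall>j. coeff f j \<noteq> 0 \<longrightarrow> j \<in> I"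
  have "f = (\<Sum>i\<le>degree f. smult (coeff f i) (monom 1 i))"
    by (simp add: smult_monom poly_as_sum_of_monoms)
  also have "\<dots> \<in> monomial_space I"
    unfolding monomial_space_def
  proof (rule cpoly.span_sum)
    fix i
    show "smult (coeff f i) (monom 1 i) \<in> cpoly.span ((\<lambda>i. monom 1 i) ` I)"
      using f by (cases "coeff f i = 0")
        (simp_all add: cpoly.span_zero cpoly.span_scale cpoly.span_base)
  qed
  finally show "f \<in> monomial_space I" .
qed

lemma has_degree_iff: "has_degree T m \<longleftrightarrow> (\<forall>m' i. m' \<noteq> m \<longrightarrow> opsym T m' i = 0)"
proof -
  \<comment> \<open>The span in \<open>has_degree\<close> is itself a monomial space, so the support
    criterion applies to it too.\<close>
  have eq: "{monom 1 k | k::nat. int k = int i + m} = (\<lambda>k. monom (1::complex) k) ` {k. int k = int i + m}" for i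
    by auto
  have "has_degree T m \<longleftrightarrow> (\<forall>i j. coeff (T (monom 1 i)) j \<noteq> 0 \<longrightarrow> int j = int i + m)"
    unfolding has_degree_def eq monomial_space_def[symmetric] mem_monomial_space by simp
  also have "\<dots> \<longleftrightarrow> (\<forall>m' i. m' \<noteq> m \<longrightarrow> opsym T m' i = 0)"
  proof (intro iffI allI impI)
    fix m' i assume "\<forall>i j. coeff (T (monom 1 i)) j \<noteq> 0 \<longrightarrow> int j = int i + m" "m' \<noteq> m"
    then show "opsym T m' i = 0"
      unfolding opsym_def by (metis add_left_cancel int_nat_eq)
  next
    fix i j assume "\<forall>m' i. m' \<noteq> m \<longrightarrow> opsym T m' i = 0" "coeff (T (monom 1 i)) j \<noteq> 0"
    then have "int j - int i = m" unfolding coeff_eq_opsym by blast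
    then show "int j = int i + m" by simp
  qed
  finally show ?thesis .
qed

text \<open>The coefficient of x^j in T x^i, with i in I and j outside, is the symbol at shift j -
  i, and then i is an exit for that shift. Only linearity is used, so operators of any finite order
  are covered.\<close>

lemma preserves_monomial_space_iff:
  assumes "poly_linear T"
  shows "T ` monomial_space I \<subseteq> monomial_space I \<longleftrightarrow> (\<forall>m. \<forall>i\<in>exits I m. opsym T m i = 0)"
proof
  assume L: "T ` monomial_space I \<subseteq> monomial_space I"
  show "\<forall>m. \<forall>i\<in>exits I m. opsym T m i = 0"
  proof (intro allI ballI)
    fix m i assume i: "i \<in> exits I m"
    then have "monom 1 i \<in> monomial_space I"
      by (auto simp: mem_monomial_space exits_def)
    then have "T (monom 1 i) \<in> monomial_space I"
      using L by blast
    moreover have "nat (int i + m) \<notin> I"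
      using i by (auto simp: exits_def image_iff)
    ultimately show "opsym T m i = 0"
      by (auto simp: mem_monomial_space opsym_def)
  qed
next
  assume R: "\<forall>m. \<forall>i\<in>exits I m. opsym T m i = 0"
  have *: "coeff (T (monom 1 i)) j = 0" if "i \<in> I" "j \<notin> I" for i j
    using R[rule_format, of i "int j - int i"] that
    by (simp add: coeff_eq_opsym exits_def image_iff) blast
  show "T ` monomial_space I \<subseteq> monomial_space I"
  proof
    fix g assume "g \<in> T ` monomial_space I"
    then obtain f where f: "f \<in> monomial_space I" and g: "g = T f" by auto
    have "coeff g j = 0" if "j \<notin> I" for j
      unfolding g poly_linear_expand[OF assms, of f]
      using f that by (auto simp: coeff_sum mem_monomial_space intro!: sum.neutral *)
    then show "g \<in> monomial_space I" by (auto simp: mem_monomial_space)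
  qed
qed

section \<open>Operators of order at most two and their quadratic symbols\<close>

definition op2 :: "complex poly \<Rightarrow> complex poly \<Rightarrow> complex poly \<Rightarrow> poly_operator" where
  "op2 P0 P1 P2 f = P0 * f + P1 * pderiv f + P2 * pderiv (pderiv f)"

lemma diffop_order_le_2_iff: "diffop_order_le 2 T \<longleftrightarrow> (\<exists>P0 P1 P2. T = op2 P0 P1 P2)"
proof
  assume "diffop_order_le 2 T"
  then obtain P where T: "T = (\<lambda>f. \<Sum>i\<le>2. P i * (pderiv ^^ i) f)"
    by (auto simp: diffop_order_le_def)
  have "T = op2 (P 0) (P 1) (P 2)"
    by (simp add: T op2_def fun_eq_iff numeral_2_eq_2 add_ac)
  then show "\<exists>P0 P1 P2. T = op2 P0 P1 P2" by blast
next
  assume "\<exists>P0 P1 P2. T = op2 P0 P1 P2"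
  then obtain P0 P1 P2 where T: "T = op2 P0 P1 P2" by blast
  show "diffop_order_le 2 T"
    unfolding diffop_order_le_def
    by (rule exI[of _ "\<lambda>i. if i = 0 then P0 else if i = 1 then P1 else P2"])
      (simp add: T op2_def fun_eq_iff numeral_2_eq_2 add_ac)
qed

lemma diffop_order_le_2_add:
  assumes "diffop_order_le 2 T" "diffop_order_le 2 S"
  shows "diffop_order_le 2 (\<lambda>f. T f + S f)"
proof -
  obtain P0 P1 P2 Q0 Q1 Q2 where "T = op2 P0 P1 P2" "S = op2 Q0 Q1 Q2"
    using assms by (auto simp: diffop_order_le_2_iff)
  then have "(\<lambda>f. T f + S f) = op2 (P0 + Q0) (P1 + Q1) (P2 + Q2)"
    by (simp add: op2_def fun_eq_iff algebra_simps)
  then show ?thesis by (auto simp: diffop_order_le_2_iff)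
qed

lemma diffop_order_le_2_smult:
  assumes "diffop_order_le 2 T"
  shows "diffop_order_le 2 (\<lambda>f. smult c (T f))"
proof -
  obtain P0 P1 P2 where "T = op2 P0 P1 P2"
    using assms by (auto simp: diffop_order_le_2_iff)
  then have "(\<lambda>f. smult c (T f)) = op2 (smult c P0) (smult c P1) (smult c P2)"
    by (simp add: op2_def fun_eq_iff smult_add_right)
  then show ?thesis by (auto simp: diffop_order_le_2_iff)
qed

text \<open>Extending coefficients by zero to negative indices lets one formula serve all integer
  degrees, including -1 and -2.\<close>

definition int_coeff :: "complex poly \<Rightarrow> int \<Rightarrow> complex" where
  "int_coeff P k = (if k \<ge> 0 then coeff P (nat k) else 0)"

text \<open>The term x^k \<partial>^j sends x^i to i(i-1)...(i-j+1) x^(i+k-j), so P_j contributes to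
  degree m through its coefficient at m + j. The formula also holds for i + m < 0: there a falling
  factorial or a coefficient of negative index annihilates each term.\<close>

lemma opsym_op2:
  "opsym (op2 P0 P1 P2) m i =
     int_coeff P0 m + of_nat i * int_coeff P1 (m + 1) + of_nat i * (of_nat i - 1) * int_coeff P2 (m + 2)"
proof -
  have c0: "coeff (P * monom c i) j = c * int_coeff P (int j - int i)" for P c i j
    by (subst mult.commute) (auto simp: coeff_monom_mult int_coeff_def nat_diff_distrib)
  \<comment> \<open>The exponents i - 1 and i - 2 produced by differentiation are truncated for i =
    0 and i = 1.\<close>
  consider "i = 0" | "i = 1" | k where "i = Suc (Suc k)"
    by (metis One_nat_def not0_implies_Suc)
  then show ?thesis
  proof cases
    case 1
    then show ?thesis by (auto simp: opsym_def op2_def pderiv_monom c0 int_coeff_def)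
  next
    case 2
    then show ?thesis
      by (auto simp: opsym_def op2_def pderiv_monom c0) (simp_all add: int_coeff_def algebra_simps)
  next
    case 3
    then show ?thesis
      by (auto simp: opsym_def op2_def pderiv_monom c0) (simp_all add: int_coeff_def algebra_simps)
  qed
qed

lemma opsym_two_roots:
  assumes T: "diffop_order_le 2 T" and "j \<noteq> k" "opsym T m j = 0" "opsym T m k = 0"
  shows "\<exists>\<alpha>. \<forall>i. opsym T m i = \<alpha> * (of_nat i - of_nat j) * (of_nat i - of_nat k)"
proof -
  obtain a b c where q: "\<And>i. opsym T m i = a + of_nat i * b + of_nat i * (of_nat i - 1) * c"
    using T opsym_op2 by (auto simp: diffop_order_le_2_iff)
  define J K where "J = (of_nat j :: complex)" and "K = (of_nat k :: complex)"
  have "J - K \<noteq> 0" using assms(2) by (simp add: J_def K_def)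
  have 1: "a + J * b + J * (J - 1) * c = 0" "a + K * b + K * (K - 1) * c = 0"
    using assms(3,4) by (simp_all add: q J_def K_def)
  \<comment> \<open>The difference of the two equations is divisible by J - K; it fixes b, and then
    a, in terms of c, which is the scalar sought.\<close>
  then have "(J - K) * (b + (J + K - 1) * c) = 0" by algebra
  then have b: "b = - (J + K - 1) * c" using \<open>J - K \<noteq> 0\<close> by (simp add: eq_neg_iff_add_eq_0 del: minus_add_distrib minus_diff_eq flip: minus_mult_left)
  have a: "a = J * K * c" using 1(1) unfolding b by algebra
  have "opsym T m i = c * (of_nat i - J) * (of_nat i - K)" for i
    unfolding q a b by (simp add: algebra_simps)
  then show ?thesis unfolding J_def K_def by blast
qed

text \<open>With two zeros factored out, a third forces the remaining scalar to be 0.\<close>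

lemma opsym_three_roots:
  assumes "diffop_order_le 2 T" and "\<not> card R \<le> 2" "\<And>i. i \<in> R \<Longrightarrow> opsym T m i = 0"
  shows "opsym T m i = 0"
proof -
  obtain A where "A \<subseteq> R" "card A = 3"
    using assms(2) by (metis Suc_eq_plus1 eval_nat_numeral(3) not_less_eq_eq obtain_subset_with_card_n)
  then obtain j k l where jkl: "j \<in> R" "k \<in> R" "l \<in> R" "j \<noteq> k" "l \<noteq> j" "l \<noteq> k"
    by (auto simp: card_3_iff)
  obtain \<alpha> where \<alpha>: "\<And>i. opsym T m i = \<alpha> * (of_nat i - of_nat j) * (of_nat i - of_nat k)"
    using opsym_two_roots[OF assms(1) jkl(4)] assms(3) jkl by blast
  have "\<alpha> = 0" using \<alpha>[of l] assms(3) jkl by auto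
  then show ?thesis using \<alpha> by simp
qed

lemma second_order_ops_preserving_iff:
  "T \<in> second_order_ops_preserving (monomial_space I) \<longleftrightarrow>
     diffop_order_le 2 T \<and> (\<forall>m. \<forall>i\<in>exits I m. opsym T m i = 0)"
  unfolding second_order_ops_preserving_def diffops_preserving_def
  using preserves_monomial_space_iff[of T I] diffop_order_le_linear[of 2 T]
  by (auto simp: diffop_def)

subsection \<open>Homogeneous components\<close>

text \<open>At shift m only the component of degree m contributes, so T determines the symbol of
  each component; uniqueness of the decomposition follows.\<close>

lemma opsym_decomposition:
  assumes "homogeneous_decomposition T Tc"
  shows "opsym (Tc m) m' i = (if m' = m then opsym T m i else 0)"
proof -
  let ?S = "{m. Tc m \<noteq> (\<lambda>_. 0)}"
  have fin: "finite ?S" and deg: "\<And>m. has_degree (Tc m) m"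
    and T: "T = (\<lambda>f. \<Sum>m\<in>?S. Tc m f)"
    using assms unfolding homogeneous_decomposition_def by blast+
  have "opsym T m i = (\<Sum>k\<in>?S. opsym (Tc k) m i)"
    by (subst T) (rule opsym_sum)
  also have "\<dots> = (\<Sum>k\<in>?S. if k = m then opsym (Tc m) m i else 0)"
    using deg by (intro sum.cong) (auto simp: has_degree_iff)
  \<comment> \<open>If m is missing from the index set, the sum is 0, and so is the symbol of the
    zero operator \<open>Tc m\<close>.\<close>
  also have "\<dots> = opsym (Tc m) m i"
    using fin by (auto simp: sum.delta opsym_zero)
  finally show ?thesis using deg by (auto simp: has_degree_iff)
qed

lemma homogeneous_decomposition_unique:
  assumes "homogeneous_decomposition T Tc" "homogeneous_decomposition T Tc'"
  shows "Tc = Tc'"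
proof
  fix m
  have "poly_linear (Tc m)" "poly_linear (Tc' m)"
    using assms diffop_order_le_linear unfolding homogeneous_decomposition_def by blast+
  then show "Tc m = Tc' m"
    by (rule poly_linear_eqI) (simp add: opsym_decomposition[OF assms(1)] opsym_decomposition[OF assms(2)])
qed

definition coeff_monom_part :: "complex poly \<Rightarrow> int \<Rightarrow> complex poly" where
  "coeff_monom_part P k = (if k \<ge> 0 then monom (coeff P (nat k)) (nat k) else 0)"

lemma int_coeff_part: "int_coeff (coeff_monom_part P k) k' = (if k' = k then int_coeff P k else 0)"
  by (auto simp: int_coeff_def coeff_monom_part_def)

lemma coeff_monom_part_eq_0:
  "k < 0 \<or> k > int (degree P) \<Longrightarrow> coeff_monom_part P k = 0"
  by (auto simp: coeff_monom_part_def coeff_eq_0)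

lemma homogeneous_decomposition_exists:
  assumes "diffop_order_le 2 T"
  shows "\<exists>Tc. homogeneous_decomposition T Tc"
proof -
  obtain P0 P1 P2 where T: "T = op2 P0 P1 P2"
    using assms by (auto simp: diffop_order_le_2_iff)
  \<comment> \<open>A term x^k \<partial>^j has degree k - j, so degree m takes the exponent m + j
    from P_j.\<close>
  define Tc where "Tc m = op2 (coeff_monom_part P0 m) (coeff_monom_part P1 (m + 1))
    (coeff_monom_part P2 (m + 2))" for m
  let ?S = "{m. Tc m \<noteq> (\<lambda>_. 0)}"
  \<comment> \<open>At order two no degree is below -2; the sum of the three degrees is a crude
    upper bound serving all coefficients at once.\<close>
  have "?S \<subseteq> {- 2..int (degree P0 + degree P1 + degree P2)}"
  proof
    fix m assume "m \<in> ?S"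
    then show "m \<in> {- 2..int (degree P0 + degree P1 + degree P2)}"
      by (rule contrapos_pp) (auto simp: Tc_def op2_def fun_eq_iff coeff_monom_part_eq_0)
  qed
  then have fin: "finite ?S" by (rule finite_subset) simp
  have ord: "diffop_order_le 2 (Tc m)" for m
    by (auto simp: diffop_order_le_2_iff Tc_def)
  have sym: "opsym (Tc m) m' i = (if m' = m then opsym T m i else 0)" for m m' i
    by (simp add: Tc_def T opsym_op2 int_coeff_part)
  have "T = (\<lambda>f. \<Sum>m\<in>?S. Tc m f)"
  proof (rule poly_linear_eqI)
    show "opsym T m i = opsym (\<lambda>f. \<Sum>m\<in>?S. Tc m f) m i" for m i
    proof -
      have "Tc m = (\<lambda>_. 0) \<Longrightarrow> opsym T m i = 0"
        using sym[of m m i] by (simp add: opsym_zero)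
      then show ?thesis
        using fin by (auto simp: opsym_sum sym)
    qed
  qed (use assms ord in \<open>auto intro!: poly_linear_sum_operators intro: diffop_order_le_linear\<close>)
  then show ?thesis
    using fin ord sym unfolding homogeneous_decomposition_def has_degree_iff by (intro exI[of _ Tc]) auto
qed

section \<open>Symbols of the explicit operators in the normal form\<close>

lemma opsym_degree0:
  "opsym (degree0_op a b c) m i =
     (if m = 0 then a * of_nat i * (of_nat i - 1) + b * of_nat i + c else 0)"
  and diffop_order_le_2_degree0: "diffop_order_le 2 (degree0_op a b c)"
proof -
  have eq: "degree0_op a b c = op2 [:c:] (monom b 1) (monom a 2)"
    by (simp add: degree0_op_def op2_def fun_eq_iff smult_monom flip: mult_smult_left)
  show "opsym (degree0_op a b c) m i =
     (if m = 0 then a * of_nat i * (of_nat i - 1) + b * of_nat i + c else 0)"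
    unfolding eq opsym_op2 by (auto simp: int_coeff_def nat_eq_iff coeff_pCons split: nat.split)
  show "diffop_order_le 2 (degree0_op a b c)"
    by (auto simp: diffop_order_le_2_iff eq)
qed

lemma has_degree_0_eq_degree0:
  assumes T: "diffop_order_le 2 T" and "has_degree T 0"
  shows "\<exists>a b c. T = degree0_op a b c"
proof -
  obtain P0 P1 P2 where P: "T = op2 P0 P1 P2"
    using T by (auto simp: diffop_order_le_2_iff)
  have "T = degree0_op (int_coeff P2 2) (int_coeff P1 1) (int_coeff P0 0)"
  proof (rule poly_linear_eqI)
    show "opsym T m i = opsym (degree0_op (int_coeff P2 2) (int_coeff P1 1) (int_coeff P0 0)) m i" for m i
      using assms(2) by (cases "m = 0") (auto simp: opsym_degree0 has_degree_iff, simp add: P opsym_op2)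
  qed (use T diffop_order_le_2_degree0 diffop_order_le_linear in blast)+
  then show ?thesis by blast
qed

lemma exits_0 [simp]: "exits I 0 = {}"
  by (auto simp: exits_def)

lemma opsym_raise:
  "opsym (\<lambda>f. monom 1 k * xD_minus a (xD_minus b f)) m i =
     (if m = int k then (of_nat i - of_nat a) * (of_nat i - of_nat b) else 0)"
  and diffop_order_le_2_raise: "diffop_order_le 2 (\<lambda>f. monom 1 k * xD_minus a (xD_minus b f))"
proof -
  \<comment> \<open>These are the coefficients of (x\<partial> - a)(x\<partial> - b) =
    x^2\<partial>^2 + (1 - a - b) x\<partial> + ab, multiplied by x^k.\<close>
  have eq: "(\<lambda>f. monom 1 k * xD_minus a (xD_minus b f)) =
     op2 (monom (of_nat a * of_nat b) k) (monom (1 - of_nat a - of_nat b) (k + 1)) (monom 1 (k + 2))"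
  proof
    fix f :: "complex poly"
    define X Y where "X = monom (1::complex) 1" and "Y = monom (1::complex) k"
    have X': "pderiv X = 1" by (simp add: X_def pderiv_monom)
    have P: "monom (of_nat a * of_nat b) k = smult (of_nat a * of_nat b) Y"
      "monom (1 - of_nat a - of_nat b) (k + 1) = smult (1 - of_nat a - of_nat b) (Y * X)"
      "monom (1::complex) (k + 2) = Y * X * X"
      by (simp_all add: X_def Y_def smult_monom mult_monom)
    show "monom 1 k * xD_minus a (xD_minus b f) = op2 (monom (of_nat a * of_nat b) k)
        (monom (1 - of_nat a - of_nat b) (k + 1)) (monom 1 (k + 2)) f"
      unfolding op2_def P xD_minus_def X_def[symmetric] Y_def[symmetric]
      by (simp add: X' pderiv_diff pderiv_mult pderiv_smult smult_diff_right smult_add_right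
          smult_diff_left smult_add_left distrib_left distrib_right right_diff_distrib
          left_diff_distrib mult_ac)
  qed
  show "opsym (\<lambda>f. monom 1 k * xD_minus a (xD_minus b f)) m i =
     (if m = int k then (of_nat i - of_nat a) * (of_nat i - of_nat b) else 0)"
    unfolding eq opsym_op2 by (auto simp: int_coeff_def nat_eq_iff algebra_simps)
  show "diffop_order_le 2 (\<lambda>f. monom 1 k * xD_minus a (xD_minus b f))"
    unfolding eq by (auto simp: diffop_order_le_2_iff)
qed

lemma opsym_lower:
  "opsym (\<lambda>f. pderiv (xD_minus b f)) m i = (if m = -1 then of_nat i * (of_nat i - of_nat b) else 0)"
  and diffop_order_le_2_lower: "diffop_order_le 2 (\<lambda>f. pderiv (xD_minus b f))"
proof -
  \<comment> \<open>Expanded, \<partial>(x\<partial> - b) is x\<partial>^2 + (1 -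
    b)\<partial>.\<close>
  have eq: "(\<lambda>f. pderiv (xD_minus b f)) = op2 0 [:1 - of_nat b:] (monom 1 1)"
    by (simp add: fun_eq_iff xD_minus_def op2_def pderiv_diff pderiv_mult pderiv_smult pderiv_monom
        smult_diff_left)
  show "opsym (\<lambda>f. pderiv (xD_minus b f)) m i = (if m = -1 then of_nat i * (of_nat i - of_nat b) else 0)"
    unfolding eq opsym_op2 by (auto simp: int_coeff_def nat_eq_iff algebra_simps coeff_pCons split: nat.split)
  show "diffop_order_le 2 (\<lambda>f. pderiv (xD_minus b f))"
    unfolding eq by (auto simp: diffop_order_le_2_iff)
qed

lemma opsym_pderiv2:
  "opsym (\<lambda>f. pderiv (pderiv f)) m i = (if m = -2 then of_nat i * (of_nat i - 1) else 0)"
  and diffop_order_le_2_pderiv2: "diffop_order_le 2 (\<lambda>f. pderiv (pderiv f))"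
proof -
  have eq: "(\<lambda>f. pderiv (pderiv f)) = op2 0 0 1"
    by (simp add: fun_eq_iff op2_def)
  show "opsym (\<lambda>f. pderiv (pderiv f)) m i = (if m = -2 then of_nat i * (of_nat i - 1) else 0)"
    unfolding eq opsym_op2 by (auto simp: int_coeff_def nat_eq_iff algebra_simps)
  show "diffop_order_le 2 (\<lambda>f. pderiv (pderiv f))"
    unfolding eq by (auto simp: diffop_order_le_2_iff)
qed

subsection \<open>Decomposition into chains\<close>

lemma chain_iff: "x \<in> chain m a r \<longleftrightarrow> (\<exists>k<r. x = a - k * m)"
  by (auto simp: chain_def)

text \<open>This guarantees that no subtraction occurring inside a chain is truncated.\<close>

lemma chain_offset_le:
  fixes k r m a :: nat
  assumes "(r - 1) * m \<le> a" "k < r"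
  shows "k * m \<le> a"
proof -
  have "k * m \<le> (r - 1) * m" using assms(2) by (intro mult_le_mono1) linarith
  then show ?thesis using assms(1) by (rule le_trans)
qed

text \<open>Maximality here is only downwards; at the top it is the separate condition that e is an
  exit. The guard \<open>r * m \<le> e\<close> matters: without it the truncated difference would be
  0, which may lie in I.\<close>

definition maximal_chain :: "nat set \<Rightarrow> nat \<Rightarrow> nat \<Rightarrow> nat \<Rightarrow> bool" where
  "maximal_chain I m e r \<longleftrightarrow> r \<ge> 1 \<and> (r - 1) * m \<le> e \<and> chain m e r \<subseteq> I \<and>
     (r * m \<le> e \<longrightarrow> e - r * m \<notin> I)"

lemma maximal_chain_exists:
  assumes "e \<in> I" "m > 0"
  shows "\<exists>r. maximal_chain I m e r"
proof -
  define r where "r = (LEAST r. \<not> (r * m \<le> e \<and> e - r * m \<in> I))"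
  \<comment> \<open>Since m is positive, \<open>Suc e\<close> steps down from e would be negative,
    so a least failing r exists.\<close>
  have "Suc e \<le> Suc e * m" using assms(2) by (metis Suc_leI mult.right_neutral mult_le_mono2 One_nat_def)
  then have "\<not> (Suc e * m \<le> e \<and> e - Suc e * m \<in> I)" by simp
  then have r: "\<not> (r * m \<le> e \<and> e - r * m \<in> I)"
    unfolding r_def by (rule LeastI)
  have less: "k * m \<le> e \<and> e - k * m \<in> I" if "k < r" for k
    using not_less_Least that unfolding r_def by blast
  have "r \<ge> 1" using r assms(1) by (cases r) auto
  then show ?thesis
    using r less[of "r - 1"] less by (intro exI[of _ r]) (auto simp: maximal_chain_def chain_iff)
qed

lemma mem_exits_nat: "e \<in> exits I (int m) \<longleftrightarrow> e \<in> I \<and> e + m \<notin> I"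
  by (auto simp: exits_def simp flip: of_nat_add)

lemma mem_exits_neg: "e \<in> exits I (- int m) \<longleftrightarrow> e \<in> I \<and> m \<le> e \<and> e - m \<notin> I"
proof (cases "m \<le> e")
  case True
  then have eq: "int e + - int m = int (e - m)" by simp
  have mem: "int (e - m) \<in> int ` I \<longleftrightarrow> e - m \<in> I"
    by (rule inj_image_mem_iff[OF inj_of_nat])
  show ?thesis unfolding exits_def mem_Collect_eq eq mem using True by simp
qed (auto simp: exits_def)

lemma finite_exits: "finite I \<Longrightarrow> finite (exits I m)"
  by (simp add: exits_def)

text \<open>Climbing by m from x must leave the finite set; the last point inside is an exit, and
  the whole path up to it stays in I.\<close>

lemma exits_above:
  assumes "finite I" "x \<in> I" "m > 0"
  shows "\<exists>j. x + j * m \<in> exits I (int m) \<and> (\<forall>k\<le>j. x + k * m \<in> I)"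
proof -
  define j where "j = (LEAST j. x + Suc j * m \<notin> I)"
  obtain b where b: "\<And>y. y \<in> I \<Longrightarrow> y \<le> b" using assms(1) finite_nat_set_iff_bounded_le by auto
  have "Suc b \<le> Suc b * m" using assms(3) by (metis Suc_leI mult.right_neutral mult_le_mono2 One_nat_def)
  then have "x + Suc b * m \<notin> I" using b[of "x + Suc b * m"] by linarith
  then have 1: "x + Suc j * m \<notin> I" unfolding j_def by (rule LeastI)
  have 2: "x + k * m \<in> I" if "k \<le> j" for k
  proof (cases k)
    case (Suc l)
    then show ?thesis using that not_less_Least[of l "\<lambda>j. x + Suc j * m \<notin> I"] unfolding j_def by auto
  qed (use assms in simp)
  show ?thesis
    using 1 2[of j] 2 by (intro exI[of _ j]) (auto simp: mem_exits_nat algebra_simps)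
qed

lemma maximal_chains_cover:
  assumes "finite I" "m > 0" "\<And>e. e \<in> exits I (int m) \<Longrightarrow> maximal_chain I m e (r e)"
  shows "I = (\<Union>e\<in>exits I (int m). chain m e (r e))"
proof
  show "(\<Union>e\<in>exits I (int m). chain m e (r e)) \<subseteq> I"
    using assms(3) by (auto simp: maximal_chain_def)
  show "I \<subseteq> (\<Union>e\<in>exits I (int m). chain m e (r e))"
  proof
    fix x assume "x \<in> I"
    then obtain j where j: "x + j * m \<in> exits I (int m)" "\<And>k. k \<le> j \<Longrightarrow> x + k * m \<in> I"
      using exits_above assms(1,2) by blast
    define e where "e = x + j * m"
    have mc: "maximal_chain I m e (r e)" using assms(3) j(1) by (simp add: e_def)
    have "j < r e"
    \<comment> \<open>A chain stopping above x would have its first missing point on the climbing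
      path from x to e, all of which lies in I.\<close>
    proof (rule ccontr)
      assume "\<not> j < r e"
      then have "r e \<le> j" by simp
      then have "j * m = (j - r e) * m + r e * m" by (metis add_mult_distrib le_add_diff_inverse2)
      then have "r e * m \<le> e" "e - r e * m = x + (j - r e) * m" by (simp_all add: e_def)
      then show False using mc j(2)[of "j - r e"] by (simp add: maximal_chain_def)
    qed
    then have "x \<in> chain m e (r e)" by (auto simp: chain_iff e_def)
    then show "x \<in> (\<Union>e\<in>exits I (int m). chain m e (r e))" using j(1) e_def by blast
  qed
qed

lemma maximal_chains_disjoint:
  assumes "e \<in> exits I (int m)" "e' \<in> exits I (int m)" "e \<noteq> e'"
    and "maximal_chain I m e r" "maximal_chain I m e' r'"
  shows "chain m e r \<inter> chain m e' r' = {}"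
proof -
  \<comment> \<open>If the chains meet, the tops differ by a positive multiple of m, the smaller
    being e. Then e + m lies on the chain of e' and hence in I, so e is no exit.\<close>
  have aux: False if e: "e \<in> exits I (int m)" and ne: "e \<noteq> e'" and c: "maximal_chain I m e r" "maximal_chain I m e' r'"
    and k: "k < r" "k' < r'" "e - k * m = e' - k' * m" "k \<le> k'" for e e' r r' k k'
  proof -
    have "k * m \<le> e" "k' * m \<le> e'"
      using c k chain_offset_le by (auto simp: maximal_chain_def)
    moreover obtain d where d: "k' = k + d" using k(4) le_Suc_ex by blast
    ultimately have e': "e' = e + d * m" using k(3) by (simp add: add_mult_distrib)
    then obtain d' where d': "d = Suc d'" using ne by (cases d) auto
    have "e' - d' * m \<in> chain m e' r'" using k(2) d d' unfolding chain_iff by (intro exI[of _ d']) simp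
    moreover have "e' - d' * m = e + m" by (simp add: e' d')
    ultimately show False using e c by (auto simp: maximal_chain_def mem_exits_nat)
  qed
  show ?thesis
  proof (rule ccontr)
    assume "chain m e r \<inter> chain m e' r' \<noteq> {}"
    then obtain k k' where "k < r" "k' < r'" "e - k * m = e' - k' * m"
      by (auto simp: chain_iff)
    then show False
      using aux[of e e' r r' k k'] aux[of e' e r' r k' k] assms by (metis nat_le_linear)
  qed
qed

lemma maximal_chain_bottom_mem:
  assumes "maximal_chain I m e r"
  shows "e - (r - 1) * m \<in> chain m e r"
  using assms by (auto simp: chain_iff maximal_chain_def intro!: exI[of _ "r - 1"])

lemma maximal_chain_bottom:
  assumes "maximal_chain I m e r"
  shows "e - (r - 1) * m < m \<or> e - (r - 1) * m \<in> exits I (- int m)"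
proof -
  have r: "r * m = (r - 1) * m + m" using assms by (cases r) (auto simp: maximal_chain_def)
  have "e - (r - 1) * m \<in> I" using assms maximal_chain_bottom_mem[OF assms] by (auto simp: maximal_chain_def)
  then show ?thesis
    using assms by (auto simp: mem_exits_neg maximal_chain_def r)
qed

text \<open>Any element above the bottom has its lower neighbour in the chain, hence in I.\<close>

lemma maximal_chain_negative_exit:
  assumes "maximal_chain I m e r" "x \<in> chain m e r" "x \<in> exits I (- int m)"
  shows "x = e - (r - 1) * m"
proof (rule ccontr)
  obtain k where k: "k < r" "x = e - k * m" using assms(2) by (auto simp: chain_iff)
  assume "x \<noteq> e - (r - 1) * m"
  then have "Suc k < r" using k by (cases "k = r - 1") auto
  then have "e - Suc k * m \<in> chain m e r" unfolding chain_iff by blast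
  then have "e - Suc k * m \<in> I" using assms(1) by (auto simp: maximal_chain_def)
  then show False using assms(3) k by (simp add: mem_exits_neg add.commute)
qed

text \<open>The map from a top to the bottom of its maximal chain is injective because distinct
  chains are disjoint. This transfers the count for degree m to degree -m.\<close>

lemma card_exits_le:
  assumes "finite I" "m > 0"
  shows "card (exits I (int m)) \<le> card ({..<m} \<union> exits I (- int m))"
proof -
  have "\<forall>e\<in>exits I (int m). \<exists>r. maximal_chain I m e r"
    using maximal_chain_exists assms(2) by (auto simp: mem_exits_nat)
  then obtain r where r: "\<And>e. e \<in> exits I (int m) \<Longrightarrow> maximal_chain I m e (r e)" by metis
  show ?thesis
  proof (rule card_inj_on_le[where f = "\<lambda>e. e - (r e - 1) * m"])
    show "inj_on (\<lambda>e. e - (r e - 1) * m) (exits I (int m))"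
    proof (rule inj_onI, rule ccontr)
      fix e e' assume e: "e \<in> exits I (int m)" "e' \<in> exits I (int m)"
        and eq: "e - (r e - 1) * m = e' - (r e' - 1) * m" and "e \<noteq> e'"
      then have "chain m e (r e) \<inter> chain m e' (r e') = {}"
        using maximal_chains_disjoint r by blast
      then show False using maximal_chain_bottom_mem[OF r[OF e(1)]] maximal_chain_bottom_mem[OF r[OF e(2)]] eq
        by auto
    qed
    show "(\<lambda>e. e - (r e - 1) * m) ` exits I (int m) \<subseteq> {..<m} \<union> exits I (- int m)"
      using maximal_chain_bottom r by fastforce
  qed (simp add: finite_exits assms)
qed

lemma exits_nonempty:
  assumes "finite I" "0 \<in> I" "m > 0"
  shows "exits I (int m) \<noteq> {}"
  using exits_above assms by blast

lemma exits_pair_chains: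
  assumes "finite I" "m > 0" "exits I (int m) = {i1, i2}" "i1 \<noteq> i2"
  obtains r s where "maximal_chain I m i1 r" "maximal_chain I m i2 s"
    "I = chain m i1 r \<union> chain m i2 s" "chain m i1 r \<inter> chain m i2 s = {}"
proof -
  have e: "i1 \<in> exits I (int m)" "i2 \<in> exits I (int m)" using assms by auto
  obtain r s where rs: "maximal_chain I m i1 r" "maximal_chain I m i2 s"
    using maximal_chain_exists[of i1 I m] maximal_chain_exists[of i2 I m] e assms(2)
    by (auto simp: mem_exits_nat)
  have "I = (\<Union>e\<in>exits I (int m). chain m e (if e = i1 then r else s))"
    by (rule maximal_chains_cover) (use assms rs in auto)
  then have "I = chain m i1 r \<union> chain m i2 s" using assms(3,4) by auto
  then show ?thesis using that rs maximal_chains_disjoint[OF e assms(4) rs] by blast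
qed

text \<open>One exit makes I a single chain. As it contains 0, all its elements are multiples of m,
  and the gcd forces m = 1; a chain of step 1 down to 0 is an initial segment.\<close>

lemma exits_singleton:
  assumes "finite I" "0 \<in> I" "Gcd I = 1" "m > 0" "card (exits I (int m)) = 1"
  shows "m = 1 \<and> I = {..<card I}"
proof -
  obtain e where e: "exits I (int m) = {e}" using assms(5) by (auto simp: card_1_singleton_iff)
  then have "e \<in> I" using mem_exits_nat by blast
  then obtain r where r: "maximal_chain I m e r"
    using maximal_chain_exists assms(4) by blast
  have I: "I = chain m e r"
    using maximal_chains_cover[OF assms(1,4), of "\<lambda>_. r"] e r by auto
  obtain k where k: "k < r" "e \<le> k * m" using assms(2) by (auto simp: I chain_iff)
  \<comment> \<open>Membership of 0 gives only one inequality because of truncation; the other is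
    the length bound of the chain.\<close>
  then have em: "e = k * m" using r chain_offset_le by (auto simp: maximal_chain_def intro!: antisym)
  have "m dvd x" if "x \<in> I" for x
    using that by (auto simp: I chain_iff em simp flip: diff_mult_distrib)
  then have "m dvd Gcd I" by (rule Gcd_greatest)
  then have m: "m = 1" using assms(3) by simp
  have "r - 1 \<le> e" using r m by (simp add: maximal_chain_def)
  then have "k = r - 1" using k m em by simp
  then have "x \<in> I \<longleftrightarrow> x < r" for x
    using k unfolding I chain_iff em m by (auto intro!: exI[of _ "r - 1 - x"])
  then have "I = {..<r}" by blast
  then show ?thesis using m by simp
qed

section \<open>A splitting determines its step\<close>

lemma chain_step_unique:
  assumes "chain m a r = chain m' a' r'" "m > 0" "m' > 0" "r \<ge> 2" "(r - 1) * m \<le> a" "(r' - 1) * m' \<le> a'"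
  shows "m = m'"
proof -
  \<comment> \<open>The tops agree, both being maxima of the same set. The second element a - m also
    lies on the other chain, so m is a positive multiple of m'. The by-product
    \<open>r' \<ge> 2\<close> permits the same argument with the roles exchanged.\<close>
  have le: "m' \<le> m" "r' \<ge> 2" "a' = a"
    if eq: "chain m a r = chain m' a' r'" and "m > 0" "m' > 0" and r: "r \<ge> 2" and b: "(r - 1) * m \<le> a" "(r' - 1) * m' \<le> a'"
    for m a r m' a' r' :: nat
  proof -
    have "a \<in> chain m a r" "a - m \<in> chain m a r"
      using r by (auto simp: chain_iff intro: exI[of _ 0] exI[of _ 1])
    then obtain k k' where k: "a = a' - k * m'" "k < r'" "a - m = a' - k' * m'" "k' < r'"
      by (auto simp: eq chain_iff)
    then have "a' \<in> chain m' a' r'" by (auto simp: chain_iff intro!: exI[of _ 0])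
    then obtain l where "a' = a - l * m" by (auto simp: chain_iff simp flip: eq)
    then show a: "a' = a" using k by linarith
    have "m \<le> a" using chain_offset_le[OF b(1), of 1] r by simp
    moreover have "k' * m' \<le> a'" using chain_offset_le[OF b(2)] k by simp
    ultimately have m: "m = k' * m'" using k a by linarith
    then have "k' \<noteq> 0" using \<open>m > 0\<close> by (cases k') auto
    then show "m' \<le> m" "r' \<ge> 2" using m k by auto
  qed
  show ?thesis
    using le[OF assms] le[OF assms(1)[symmetric]] assms by (metis le_antisym)
qed

lemma is_chain_step_unique:
  assumes "is_chain m A" "is_chain m' A" "m > 0" "m' > 0" "card A \<ge> 2"
  shows "m = m'"
proof -
  obtain a r a' r' where A: "A = chain m a r" "A = chain m' a' r'"
    and b: "(r - 1) * m \<le> a" "(r' - 1) * m' \<le> a'"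
    using assms(1,2) unfolding is_chain_def by blast
  have "chain m a r = (\<lambda>k. a - k * m) ` {..<r}" by (auto simp: chain_def)
  then have "card A \<le> r" using card_image_le[of "{..<r}" "\<lambda>k. a - k * m"] by (simp add: A(1))
  then show ?thesis using chain_step_unique[of m a r m' a' r'] A b assms by auto
qed

text \<open>One of the chains has at least two elements. Since both members of the second pair have
  step m', it does not matter how the unordered pairs are matched.\<close>

lemma splitting_step_unique:
  assumes A: "A \<inter> B = {}" "A \<union> B = I" "is_chain m A" "is_chain m B" "m > 0"
    and A': "is_chain m' A'" "is_chain m' B'" "m' > 0"
    and eq: "{A, B} = {A', B'}" and card: "card I \<ge> 3"
  shows "m = m'"
proof -
  have "card I \<le> card A + card B" using A(2) card_Un_le by blast
  then have "card A \<ge> 2 \<or> card B \<ge> 2" using card by linarith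
  moreover have "is_chain m' A" "is_chain m' B" using eq A' by (auto simp: doubleton_eq_iff)
  ultimately show ?thesis using is_chain_step_unique A A' by blast
qed

lemma exits_pair_splitting:
  assumes "finite I" "m > 0" "card (exits I (int m)) = 2"
  obtains A B where "A \<inter> B = {}" "A \<union> B = I" "is_chain m A" "is_chain m B"
proof -
  obtain i1 i2 where "exits I (int m) = {i1, i2}" "i1 \<noteq> i2" using assms(3) by (auto simp: card_2_iff)
  then obtain r s where "maximal_chain I m i1 r" "maximal_chain I m i2 s"
    "I = chain m i1 r \<union> chain m i2 s" "chain m i1 r \<inter> chain m i2 s = {}"
    using exits_pair_chains assms by metis
  then show ?thesis using that[of "chain m i1 r" "chain m i2 s"]
    unfolding is_chain_def maximal_chain_def by blast
qed

text \<open>The set {0} has gcd 0, and a pair {0, a} with gcd 1 is {0, 1}, which has a single exit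
  for m = 1.\<close>

lemma card_ge_3_if_no_single_exit:
  assumes "finite I" "0 \<in> I" "Gcd I = 1" "card (exits I 1) \<noteq> 1"
  shows "card I \<ge> 3"
proof (rule ccontr)
  assume "\<not> card I \<ge> 3"
  then have "card I \<le> 2" by simp
  have "I \<noteq> {0}" using assms(3) by auto
  then obtain a where a: "a \<in> I" "a \<noteq> 0" using assms(2) by blast
  then have "I = {0, a}" using card_subset_eq[OF assms(1), of "{0,a}"] assms(2) \<open>card I \<le> 2\<close>
      card_mono[OF assms(1), of "{0,a}"] by auto
  moreover from this have "a = 1" using assms(3) by simp
  ultimately have "I = {0, 1}" by simp
  then have "exits I 1 = {1}" by (auto simp: exits_def)
  then show False using assms(4) by simp
qed

text \<open>Contrapositively, every positive step other than m has at least three exits, which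
  eliminates the degrees other than 0, m and -m.\<close>

lemma unique_splitting_step:
  assumes I: "finite I" "0 \<in> I" "Gcd I = 1" "\<forall>l>0. card (exits I l) \<noteq> 1"
    and S: "\<exists>!S. S \<in> splittings I"
    and m: "m > 0" "card (exits I (int m)) = 2" and m': "m' > 0" "card (exits I (int m')) \<le> 2"
  shows "m' = m"
proof -
  have "card (exits I (int m')) \<noteq> 0" "card (exits I (int m')) \<noteq> 1"
    using exits_nonempty[OF I(1,2) m'(1)] finite_exits[OF I(1)] I(4) m'(1) by auto
  then have m'2: "card (exits I (int m')) = 2" using m'(2) by linarith
  obtain A B where AB: "A \<inter> B = {}" "A \<union> B = I" "is_chain m A" "is_chain m B"
    using exits_pair_splitting[OF I(1) m] .
  obtain A' B' where AB': "A' \<inter> B' = {}" "A' \<union> B' = I" "is_chain m' A'" "is_chain m' B'"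
    using exits_pair_splitting[OF I(1) m'(1) m'2] .
  have "{A, B} \<in> splittings I" "{A', B'} \<in> splittings I"
    using AB AB' m m' unfolding splittings_def by blast+
  then have "{A, B} = {A', B'}" using S by blast
  moreover have "card I \<ge> 3" using card_ge_3_if_no_single_exit I by simp
  ultimately show ?thesis using splitting_step_unique AB AB' m m' by metis
qed

subsection \<open>The general second-order operator\<close>

lemma homogeneous_component_eq_0:
  assumes hd: "homogeneous_decomposition T Tc" and z: "\<And>i. opsym T m i = 0"
  shows "Tc m = (\<lambda>_. 0)"
proof (rule poly_linear_eqI)
  show "poly_linear (Tc m)"
    using hd diffop_order_le_linear unfolding homogeneous_decomposition_def by blast
  show "poly_linear (\<lambda>_. 0)" by (rule poly_linearI) simp_all
qed (simp add: opsym_decomposition[OF hd] z opsym_zero)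

lemma opsym_eq_0_of_card_exits:
  assumes "T \<in> second_order_ops_preserving (monomial_space I)" "\<not> card (exits I m) \<le> 2"
  shows "opsym T m i = 0"
  using assms opsym_three_roots[of T "exits I m"] by (auto simp: second_order_ops_preserving_iff)

lemma opsym_neg_eq_0:
  assumes T: "T \<in> second_order_ops_preserving (monomial_space I)"
    and "finite I" "m > 0" "\<not> card (exits I (int m)) \<le> 2"
  shows "opsym T (- int m) i = 0"
proof (rule opsym_three_roots)
  show "diffop_order_le 2 T" using T by (simp add: second_order_ops_preserving_iff)
  show "\<not> card ({..<m} \<union> exits I (- int m)) \<le> 2"
    using card_exits_le[OF assms(2,3)] assms(4) by linarith
  show "opsym T (- int m) i = 0" if "i \<in> {..<m} \<union> exits I (- int m)" for i
    using that T by (auto simp: second_order_ops_preserving_iff opsym_below)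
qed

lemma second_order_ops_degree0:
  "{T \<in> second_order_ops_preserving (monomial_space I). has_degree T 0}
     = {degree0_op \<alpha>1 \<alpha>2 \<alpha>3 | \<alpha>1 \<alpha>2 \<alpha>3. True}"
proof (intro equalityI subsetI)
  fix T assume "T \<in> {T \<in> second_order_ops_preserving (monomial_space I). has_degree T 0}"
  then show "T \<in> {degree0_op \<alpha>1 \<alpha>2 \<alpha>3 | \<alpha>1 \<alpha>2 \<alpha>3. True}"
    using has_degree_0_eq_degree0 by (auto simp: second_order_ops_preserving_iff)
next
  fix T assume "T \<in> {degree0_op \<alpha>1 \<alpha>2 \<alpha>3 | \<alpha>1 \<alpha>2 \<alpha>3. True}"
  then show "T \<in> {T \<in> second_order_ops_preserving (monomial_space I). has_degree T 0}"
    by (auto simp: second_order_ops_preserving_iff has_degree_iff diffop_order_le_2_degree0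
        opsym_degree0)
qed

lemma second_order_op_components:
  assumes T: "T \<in> second_order_ops_preserving (monomial_space I)"
  shows "(\<exists>!Tc. homogeneous_decomposition T Tc) \<and>
        (\<forall>Tc. homogeneous_decomposition T Tc \<longrightarrow>
          (\<forall>m. Tc m \<noteq> (\<lambda>_. 0) \<longrightarrow> card (exits I m) \<in> {0, 1, 2}) \<and>
          ((\<forall>m>0. card (exits I m) > 2) \<longrightarrow>
             (\<forall>m>0. Tc m = (\<lambda>_. 0)) \<and>
             (\<forall>N. T ` monomial_space {..N} \<subseteq> monomial_space {..N})) \<and>
          (\<exists>\<alpha>1 \<alpha>2 \<alpha>3. Tc 0 = degree0_op \<alpha>1 \<alpha>2 \<alpha>3)) \<and>
        (\<forall>\<alpha>1 \<alpha>2 \<alpha>3. (\<lambda>f. T f + degree0_op \<alpha>1 \<alpha>2 \<alpha>3 f)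
           \<in> second_order_ops_preserving (monomial_space I))"
proof (intro conjI allI impI)
  have ord: "diffop_order_le 2 T" using T by (simp add: second_order_ops_preserving_iff)
  show "\<exists>!Tc. homogeneous_decomposition T Tc"
    using homogeneous_decomposition_exists[OF ord] homogeneous_decomposition_unique by blast
  show "(\<lambda>f. T f + degree0_op a b c f) \<in> second_order_ops_preserving (monomial_space I)" for a b c
    using T by (auto simp: second_order_ops_preserving_iff opsym_add opsym_degree0
        intro!: diffop_order_le_2_add diffop_order_le_2_degree0)
  fix Tc assume hd: "homogeneous_decomposition T Tc"
  show "\<exists>\<alpha>1 \<alpha>2 \<alpha>3. Tc 0 = degree0_op \<alpha>1 \<alpha>2 \<alpha>3"
    using hd has_degree_0_eq_degree0 unfolding homogeneous_decomposition_def by blast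
  show "card (exits I m) \<in> {0, 1, 2}" if "Tc m \<noteq> (\<lambda>_. 0)" for m
  proof -
    have "card (exits I m) \<le> 2"
      using that homogeneous_component_eq_0[OF hd] opsym_eq_0_of_card_exits[OF T] by blast
    then show ?thesis by (auto simp: le_Suc_eq numeral_2_eq_2)
  qed
  assume large: "\<forall>m>0. card (exits I m) > 2"
  then have z: "opsym T m i = 0" if "m > 0" for m i
    using opsym_eq_0_of_card_exits[OF T, of m i] that by (simp add: not_le)
  show "Tc m = (\<lambda>_. 0)" if "m > 0" for m
    using homogeneous_component_eq_0[OF hd] z[OF that] by blast
  show "T ` monomial_space {..N} \<subseteq> monomial_space {..N}" for N
  proof -
    \<comment> \<open>An initial segment can be left only upwards, so its exits all have positive
      degree, where T has no symbol.\<close>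
    have "opsym T m i = 0" if "i \<in> exits {..N} m" for m i
    proof (rule z, rule ccontr)
      assume "\<not> m > 0"
      then have "nat (int i + m) \<le> N" "int (nat (int i + m)) = int i + m"
        using that by (auto simp: exits_def)
      then have "int i + m \<in> int ` {..N}" by (metis atMost_iff imageI)
      then show False using that by (simp add: exits_def)
    qed
    then show ?thesis
      using preserves_monomial_space_iff[OF diffop_order_le_linear[OF ord]] by blast
  qed
qed

text \<open>The scalars \<beta> and \<gamma> carry the exceptional terms, with conditions switching
  them off outside their cases, so a single normal form yields all three variants of the
  result.\<close>

lemma general_second_order_op:
  fixes m i1 i2 r s :: nat
  defines "b1 \<equiv> i1 - (r - 1) * m" and "b2 \<equiv> i2 - (s - 1) * m"
  assumes I: "finite I" "0 \<in> I" "Gcd I = 1"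
    and m: "m > 0" "exits I (int m) = {i1, i2}" "i1 > i2"
    and one: "\<forall>l>0. card (exits I l) \<noteq> 1"
    and chains: "maximal_chain I m i1 r" "maximal_chain I m i2 s"
      "I = chain m i1 r \<union> chain m i2 s" "chain m i1 r \<inter> chain m i2 s = {}"
    and S: "\<exists>!S. S \<in> splittings I"
  shows "m = 1 \<Longrightarrow> b2 = 0" (is "_ \<Longrightarrow> ?bottom")
    and "second_order_ops_preserving (monomial_space I) =
      {\<lambda>f. smult \<alpha>1 (monom 1 m * xD_minus i1 (xD_minus i2 f)) + degree0_op \<alpha>2 \<alpha>3 \<alpha>4 f
         + smult \<beta> (pderiv (xD_minus b1 f)) + smult \<gamma> (pderiv (pderiv f))
       | \<alpha>1 \<alpha>2 \<alpha>3 \<alpha>4 \<beta> \<gamma>.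
         (m = 1 \<or> \<beta> = 0) \<and> (m = 2 \<and> {b2, b1} = {0, 1} \<or> \<gamma> = 0)}"
proof -
  have b1: "b1 \<in> chain m i1 r" and b2: "b2 \<in> chain m i2 s"
    unfolding b1_def b2_def using chains maximal_chain_bottom_mem by blast+
  then have ne: "b1 \<noteq> b2" using chains(4) by auto
  have bottoms: "exits I (- int m) \<subseteq> {b1, b2}"
  proof
    fix x assume x: "x \<in> exits I (- int m)"
    then have "x \<in> I" by (simp add: exits_def)
    then show "x \<in> {b1, b2}"
      using maximal_chain_negative_exit[OF chains(1) _ x] maximal_chain_negative_exit[OF chains(2) _ x]
        chains(3) unfolding b1_def b2_def by blast
  qed
  \<comment> \<open>With step 1, an upper chain reaching 0 would be the whole interval up to i1 and
    would contain i2; hence 0 is the bottom of the lower chain.\<close>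
  have bottom: ?bottom if m1: "m = 1"
  proof -
    consider "0 \<in> chain m i1 r" | "0 \<in> chain m i2 s" using I(2) chains(3) by blast
    then show ?thesis
    proof cases
      case 1
      then obtain k where "k < r" "i1 \<le> k" using m1 by (auto simp: chain_iff)
      then have "i2 \<in> chain m i1 r"
        using m(3) m1 unfolding chain_iff by (intro exI[of _ "i1 - i2"]) simp
      moreover have "i2 \<in> chain m i2 s"
        using chains(2) by (auto simp: chain_iff maximal_chain_def intro!: exI[of _ 0])
      ultimately show ?thesis using chains(4) by blast
    next
      case 2
      then obtain k where "k < s" "i2 \<le> k" using m1 by (auto simp: chain_iff)
      then show ?thesis by (simp add: b2_def m1)
    qed
  qed
  then show "m = 1 \<Longrightarrow> ?bottom" .
  have card2: "card (exits I (int m)) = 2" using m by simp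
  note step = unique_splitting_step[OF I one S m(1) card2]
  have other: "opsym T k i = 0"
    if T: "T \<in> second_order_ops_preserving (monomial_space I)" and k: "k \<noteq> 0" "k \<noteq> int m" "k \<noteq> - int m" for T k i
  proof (cases "k > 0")
    case True
    then obtain l where l: "k = int l" "l > 0" by (metis zero_less_imp_eq_int)
    then have "\<not> card (exits I (int l)) \<le> 2" using step[of l] k by auto
    then show ?thesis using opsym_eq_0_of_card_exits[OF T] l by blast
  next
    case False
    then obtain l where l: "k = - int l" "l > 0" using k(1) by (metis linorder_neqE_linordered_idom minus_minus neg_0_less_iff_less zero_less_imp_eq_int)
    then have "\<not> card (exits I (int l)) \<le> 2" using step[of l] k by auto
    then show ?thesis using opsym_neg_eq_0[OF T I(1)] l by blast
  qed
  let ?G = "\<lambda>\<alpha>1 \<alpha>2 \<alpha>3 \<alpha>4 \<beta> \<gamma> f. smult \<alpha>1 (monom 1 m * xD_minus i1 (xD_minus i2 f))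
    + degree0_op \<alpha>2 \<alpha>3 \<alpha>4 f + smult \<beta> (pderiv (xD_minus b1 f)) + smult \<gamma> (pderiv (pderiv f))"
  let ?C = "\<lambda>\<beta> \<gamma>. (m = 1 \<or> \<beta> = 0) \<and> (m = 2 \<and> {b2, b1} = {0, 1} \<or> \<gamma> = 0)"
  have G_ord: "diffop_order_le 2 (?G \<alpha>1 \<alpha>2 \<alpha>3 \<alpha>4 \<beta> \<gamma>)" for \<alpha>1 \<alpha>2 \<alpha>3 \<alpha>4 \<beta> \<gamma>
    by (intro diffop_order_le_2_add diffop_order_le_2_smult diffop_order_le_2_raise
        diffop_order_le_2_degree0 diffop_order_le_2_lower diffop_order_le_2_pderiv2)
  have G_sym: "opsym (?G \<alpha>1 \<alpha>2 \<alpha>3 \<alpha>4 \<beta> \<gamma>) k i =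
      \<alpha>1 * (if k = int m then (of_nat i - of_nat i1) * (of_nat i - of_nat i2) else 0)
      + (if k = 0 then \<alpha>2 * of_nat i * (of_nat i - 1) + \<alpha>3 * of_nat i + \<alpha>4 else 0)
      + \<beta> * (if k = -1 then of_nat i * (of_nat i - of_nat b1) else 0)
      + \<gamma> * (if k = -2 then of_nat i * (of_nat i - 1) else 0)" for \<alpha>1 \<alpha>2 \<alpha>3 \<alpha>4 \<beta> \<gamma> k i
    by (simp only: opsym_add opsym_smult opsym_raise opsym_degree0 opsym_lower opsym_pderiv2)
  show "second_order_ops_preserving (monomial_space I) =
      {?G \<alpha>1 \<alpha>2 \<alpha>3 \<alpha>4 \<beta> \<gamma> | \<alpha>1 \<alpha>2 \<alpha>3 \<alpha>4 \<beta> \<gamma>. ?C \<beta> \<gamma>}"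
  proof (intro equalityI subsetI)
    fix T assume "T \<in> {?G \<alpha>1 \<alpha>2 \<alpha>3 \<alpha>4 \<beta> \<gamma> | \<alpha>1 \<alpha>2 \<alpha>3 \<alpha>4 \<beta> \<gamma>. ?C \<beta> \<gamma>}"
    then obtain \<alpha>1 \<alpha>2 \<alpha>3 \<alpha>4 \<beta> \<gamma> where T: "T = ?G \<alpha>1 \<alpha>2 \<alpha>3 \<alpha>4 \<beta> \<gamma>" and C: "?C \<beta> \<gamma>" by blast
    have "opsym T k i = 0" if i: "i \<in> exits I k" for k i
    proof -
      have 1: "(of_nat i - of_nat i1) * (of_nat i - of_nat i2) = (0::complex)" if "k = int m"
      proof -
        have "i = i1 \<or> i = i2" using i m(2) that by simp
        then show ?thesis by auto
      qed
      \<comment> \<open>For m = 1 the exits of degree -1 are among b1 and b2 = 0, precisely the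
        zeros of i(i - b1).\<close>
      have 2: "\<beta> * (of_nat i * (of_nat i - of_nat b1)) = (0::complex)" if "k = -1"
      proof (cases "\<beta> = 0")
        case False
        then have "m = 1" using C by blast
        then have "i \<in> {b1, b2}" using i bottoms that by auto
        then show ?thesis using bottom[OF \<open>m = 1\<close>] by auto
      qed simp
      have 3: "\<gamma> * (of_nat i * (of_nat i - 1)) = (0::complex)" if "k = -2"
      proof (cases "\<gamma> = 0")
        case False
        then have m2: "m = 2 \<and> {b2, b1} = {0, 1}" using C by (simp only: simp_thms)
        have "exits I (- int m) \<subseteq> {b2, b1}" using bottoms by (simp only: insert_commute)
        then have "i \<in> {b2, b1}" using i that m2[THEN conjunct1] by auto
        then have "i \<in> {0, 1}" using m2 by (simp only:)
        then show ?thesis by auto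
      qed simp
      have "k \<noteq> 0" using i by auto
      then show ?thesis unfolding T G_sym using 1 2 3 by auto
    qed
    then show "T \<in> second_order_ops_preserving (monomial_space I)"
      using G_ord T by (auto simp: second_order_ops_preserving_iff)
  next
    fix T assume T: "T \<in> second_order_ops_preserving (monomial_space I)"
    then have ord: "diffop_order_le 2 T" and van: "\<And>k i. i \<in> exits I k \<Longrightarrow> opsym T k i = 0"
      by (auto simp: second_order_ops_preserving_iff)
    obtain \<alpha>1 where \<alpha>1: "\<And>i. opsym T (int m) i = \<alpha>1 * (of_nat i - of_nat i1) * (of_nat i - of_nat i2)"
      using opsym_two_roots[OF ord, of i1 i2 "int m"] van m by auto
    obtain P0 P1 P2 where P: "T = op2 P0 P1 P2" using ord by (auto simp: diffop_order_le_2_iff)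
    \<comment> \<open>No exit constrains degree 0, so its three coefficients are arbitrary and are
      read off at 1, i and i(i-1).\<close>
    obtain \<alpha>2 \<alpha>3 \<alpha>4 where \<alpha>: "\<And>i. opsym T 0 i = \<alpha>2 * of_nat i * (of_nat i - 1) + \<alpha>3 * of_nat i + \<alpha>4"
      using that[of "int_coeff P2 2" "int_coeff P1 1" "int_coeff P0 0"] by (simp add: P opsym_op2)
    have low: "opsym T (- int m) i = 0" if "i < m" for i
      using that by (simp add: opsym_below)
    \<comment> \<open>A bottom is either less than m, where the target exponent is negative, or an
      exit of degree -m.\<close>
    have bv: "opsym T (- int m) b1 = 0" "opsym T (- int m) b2 = 0"
      using maximal_chain_bottom[OF chains(1)] maximal_chain_bottom[OF chains(2)] low van
      unfolding b1_def b2_def by blast+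
    have "\<exists>\<beta> \<gamma>. ?C \<beta> \<gamma> \<and> (\<forall>i. opsym T (- int m) i =
       (if m = 1 then \<beta> * (of_nat i * (of_nat i - of_nat b1)) else 0)
      + (if m = 2 then \<gamma> * (of_nat i * (of_nat i - 1)) else 0))"
    proof -
      \<comment> \<open>The forced zeros include 0, ..., m-1 and two distinct bottoms. Having only
        two of them with m different from 1 means that the bottoms already contain 0 and 1.\<close>
      consider "m = 1" | "m = 2" "{b2, b1} = {0, 1}" | "\<not> card ({..<m} \<union> {b1, b2}) \<le> 2"
      proof -
        have "{b2, b1} = {0, 1}" if "card ({..<m} \<union> {b1, b2}) \<le> 2" "m \<noteq> 1"
        proof -
          have "{b1, b2} = {..<m} \<union> {b1, b2}"
            by (rule card_seteq) (use that ne in auto)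
          then have "{..<m} \<subseteq> {b1, b2}" by blast
          moreover have "{0, 1} \<subseteq> {..<m}" using that(2) m(1) by auto
          ultimately have "{0, 1} \<subseteq> {b1, b2}" by blast
          then show ?thesis by auto
        qed
        moreover have "m \<le> 2" if "card ({..<m} \<union> {b1, b2}) \<le> 2"
        proof -
          have "card {..<m} \<le> card ({..<m} \<union> {b1, b2})" by (rule card_mono) auto
          then show ?thesis using that by simp
        qed
        ultimately show ?thesis using that m(1) by (metis One_nat_def le_SucE le_zero_eq less_numeral_extra(3) numeral_2_eq_2)
      qed
      then show ?thesis
      proof cases
        case 1
        \<comment> \<open>Since b2 = 0, this quadratic is \<beta> i(i - b1), the symbol of \<beta>
          \<partial>(x\<partial> - b1).\<close>
        obtain \<beta> where "\<And>i. opsym T (- int m) i = \<beta> * (of_nat i - of_nat b1) * (of_nat i - of_nat b2)"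
          using opsym_two_roots[OF ord ne bv] by blast
        then show ?thesis
          using 1 bottom by (intro exI[of _ \<beta>] exI[of _ 0]) (simp add: mult_ac)
      next
        case 2
        obtain \<gamma> where "\<And>i. opsym T (- int m) i = \<gamma> * (of_nat i - of_nat 0) * (of_nat i - of_nat 1)"
          using opsym_two_roots[OF ord, of 0 1 "- int m"] low 2 by auto
        then show ?thesis
          using 2 by (intro exI[of _ 0] exI[of _ \<gamma>]) (simp add: mult_ac)
      next
        case 3
        have "opsym T (- int m) i = 0" for i
          by (rule opsym_three_roots[OF ord 3]) (use bv low in auto)
        then show ?thesis by (intro exI[of _ 0]) simp
      qed
    qed
    then obtain \<beta> \<gamma> where C: "?C \<beta> \<gamma>" and \<beta>\<gamma>: "\<And>i. opsym T (- int m) i =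
       (if m = 1 then \<beta> * (of_nat i * (of_nat i - of_nat b1)) else 0)
      + (if m = 2 then \<gamma> * (of_nat i * (of_nat i - 1)) else 0)" by blast
    have m2: "m = 2 \<or> \<gamma> = 0" using C[THEN conjunct2] by (rule disj_forward) (erule conjunct1)
    have "T = ?G \<alpha>1 \<alpha>2 \<alpha>3 \<alpha>4 \<beta> \<gamma>"
    proof (rule poly_linear_eqI)
      show "opsym T k i = opsym (?G \<alpha>1 \<alpha>2 \<alpha>3 \<alpha>4 \<beta> \<gamma>) k i" for k i
      proof -
        consider "k = 0" | "k = int m" | "k = - int m" | "k \<noteq> 0" "k \<noteq> int m" "k \<noteq> - int m" by blast
        then show ?thesis
        proof cases
          case 1
          then show ?thesis unfolding G_sym using m(1) by (simp add: \<alpha>)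
        next
          case 2
          then show ?thesis unfolding G_sym using m(1) by (simp add: \<alpha>1)
        next
          case 3
          have "- int m \<noteq> int m" "- int m \<noteq> 0" "(- int m = - 1) = (m = 1)" "(- int m = - 2) = (m = 2)"
            using m(1) by auto
          then show ?thesis unfolding G_sym 3 \<beta>\<gamma> by (simp only: if_False) simp
        next
          case 4
          \<comment> \<open>As k differs from -m, k = -1 excludes m = 1 and k = -2 excludes m = 2,
            so the matching extra term is switched off.\<close>
          have "k = - 1 \<Longrightarrow> \<beta> = 0" "k = - 2 \<Longrightarrow> \<gamma> = 0"
            using C[THEN conjunct1] m2 4(3) by auto
          then show ?thesis unfolding G_sym other[OF T 4] using 4 by auto
        qed
      qed
    qed (use ord G_ord diffop_order_le_linear in blast)+
    then show "T \<in> {?G \<alpha>1 \<alpha>2 \<alpha>3 \<alpha>4 \<beta> \<gamma> | \<alpha>1 \<alpha>2 \<alpha>3 \<alpha>4 \<beta> \<gamma>. ?C \<beta> \<gamma>}" using C by blast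
  qed
qed

theorem mainTheorem3:
  fixes I :: "nat set" and n :: nat
  assumes "finite I" and "card I = n" and "0 \<in> I" and "Gcd I = 1"
  shows
    "(\<forall>T2 \<in> second_order_ops_preserving (monomial_space I).
        (\<exists>!Tc. homogeneous_decomposition T2 Tc) \<and>
        (\<forall>Tc. homogeneous_decomposition T2 Tc \<longrightarrow>
          (\<forall>m. Tc m \<noteq> (\<lambda>_. 0) \<longrightarrow> card (exits I m) \<in> {0, 1, 2}) \<and>
          \<comment> \<open>(1)\<close>
          ((\<forall>m>0. card (exits I m) > 2) \<longrightarrow>
             (\<forall>m>0. Tc m = (\<lambda>_. 0)) \<and>
             (\<forall>N. T2 ` monomial_space {..N} \<subseteq> monomial_space {..N})) \<and>
          \<comment> \<open>(2), contribution of degree 0\<close>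
          (\<exists>\<alpha>1 \<alpha>2 \<alpha>3. Tc 0 = degree0_op \<alpha>1 \<alpha>2 \<alpha>3)) \<and>
        (\<forall>\<alpha>1 \<alpha>2 \<alpha>3. (\<lambda>f. T2 f + degree0_op \<alpha>1 \<alpha>2 \<alpha>3 f)
           \<in> second_order_ops_preserving (monomial_space I))) \<and>
     \<comment> \<open>(2)\<close>
     (\<forall>m\<ge>0. exits I m = {} \<longrightarrow> m = 0) \<and>
     (\<forall>T. diffop T \<and> has_degree T 0 \<longrightarrow> T \<in> diffops_preserving (monomial_space I)) \<and>
     {T \<in> second_order_ops_preserving (monomial_space I). has_degree T 0}
       = {degree0_op \<alpha>1 \<alpha>2 \<alpha>3 | \<alpha>1 \<alpha>2 \<alpha>3. True} \<and>
     \<comment> \<open>(3)\<close>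
     (\<forall>m\<ge>0. card (exits I m) = 1 \<longrightarrow>
        m = 1 \<and> monomial_space I = monomial_space {..<n}) \<and>
     \<comment> \<open>(4)\<close>
     (\<forall>m i1 i2 :: nat.
        m > 0 \<and> exits I (int m) = {i1, i2} \<and> i1 > i2 \<and>
        (\<forall>l>0. card (exits I l) \<noteq> 1) \<longrightarrow>
        (\<exists>r s :: nat. r \<ge> 1 \<and> s \<ge> 1 \<and> (r - 1) * m \<le> i1 \<and> (s - 1) * m \<le> i2 \<and>
           I = chain m i1 r \<union> chain m i2 s \<and> chain m i1 r \<inter> chain m i2 s = {} \<and>
           ((\<exists>!S. S \<in> splittings I) \<longrightarrow>
             (let b1 = i1 - (r - 1) * m;
                  b2 = i2 - (s - 1) * m;
                  T = (\<lambda>\<alpha>1 \<alpha>2 \<alpha>3 \<alpha>4 f.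
                         smult \<alpha>1 (monom 1 m * xD_minus i1 (xD_minus i2 f))
                         + degree0_op \<alpha>2 \<alpha>3 \<alpha>4 f)
              in (m = 1 \<longrightarrow> b2 = 0 \<and>
                    second_order_ops_preserving (monomial_space I)
                      = {\<lambda>f. T \<alpha>1 \<alpha>2 \<alpha>3 \<alpha>4 f + smult \<alpha>5 (pderiv (xD_minus b1 f))
                         | \<alpha>1 \<alpha>2 \<alpha>3 \<alpha>4 \<alpha>5. True}) \<and>
                 (m = 2 \<and> {b2, b1} = {0, 1} \<longrightarrow>
                    second_order_ops_preserving (monomial_space I)
                      = {\<lambda>f. T \<alpha>1 \<alpha>2 \<alpha>3 \<alpha>4 f + smult \<alpha>5 (pderiv (pderiv f))
                         | \<alpha>1 \<alpha>2 \<alpha>3 \<alpha>4 \<alpha>5. True}) \<and>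
                 (m \<noteq> 1 \<and> \<not> (m = 2 \<and> {b2, b1} = {0, 1}) \<longrightarrow>
                    second_order_ops_preserving (monomial_space I)
                      = {T \<alpha>1 \<alpha>2 \<alpha>3 \<alpha>4 | \<alpha>1 \<alpha>2 \<alpha>3 \<alpha>4. True})))))"
proof (intro conjI ballI allI impI)
  fix T2 assume "T2 \<in> second_order_ops_preserving (monomial_space I)"
  note comp = second_order_op_components[OF this]
  show "\<exists>!Tc. homogeneous_decomposition T2 Tc"
    by (rule comp[THEN conjunct1])
  show "(\<lambda>f. T2 f + degree0_op a b c f) \<in> second_order_ops_preserving (monomial_space I)" for a b c
    by (rule comp[THEN conjunct2, THEN conjunct2, rule_format])
  fix Tc assume "homogeneous_decomposition T2 Tc"
  note comp = comp[THEN conjunct2, THEN conjunct1, THEN spec, THEN mp, OF this]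
  show "\<exists>\<alpha>1 \<alpha>2 \<alpha>3. Tc 0 = degree0_op \<alpha>1 \<alpha>2 \<alpha>3"
    by (rule comp[THEN conjunct2, THEN conjunct2])
  show "card (exits I m) \<in> {0, 1, 2}" if "Tc m \<noteq> (\<lambda>_. 0)" for m
    by (rule comp[THEN conjunct1, rule_format, OF that])
  assume "\<forall>m>0. card (exits I m) > 2"
  note comp = comp[THEN conjunct2, THEN conjunct1, THEN mp, OF this]
  show "Tc m = (\<lambda>_. 0)" if "m > 0" for m
    by (rule comp[THEN conjunct1, rule_format, OF that])
  show "T2 ` monomial_space {..N} \<subseteq> monomial_space {..N}" for N
    by (rule comp[THEN conjunct2, rule_format])
next
  show "m = 0" if "m \<ge> 0" "exits I m = {}" for m
    using exits_nonempty[OF assms(1,3), of "nat m"] that by (cases "m = 0") auto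
  show "T \<in> diffops_preserving (monomial_space I)" if "diffop T \<and> has_degree T 0" for T
    \<comment> \<open>A degree 0 operator has symbol only at shift 0, where there are no exits;
      hence no bound on the order enters.\<close>
    using that preserves_monomial_space_iff[OF diffop_linear, of T I]
    unfolding diffops_preserving_def has_degree_iff
    by (metis (mono_tags, lifting) exits_0 empty_iff mem_Collect_eq)
  show "{T \<in> second_order_ops_preserving (monomial_space I). has_degree T 0}
       = {degree0_op \<alpha>1 \<alpha>2 \<alpha>3 | \<alpha>1 \<alpha>2 \<alpha>3. True}"
    by (rule second_order_ops_degree0)
next
  fix m :: int assume m: "m \<ge> 0" "card (exits I m) = 1"
  then have "m \<noteq> 0" by auto
  then have "nat m > 0" "int (nat m) = m" using m(1) by auto
  then have "nat m = 1 \<and> I = {..<card I}"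
    using exits_singleton[OF assms(1,3,4), of "nat m"] m(2) by simp
  then show "m = 1" "monomial_space I = monomial_space {..<n}" using assms(2) by auto
next
  fix m i1 i2 :: nat
  assume "m > 0 \<and> exits I (int m) = {i1, i2} \<and> i1 > i2 \<and> (\<forall>l>0. card (exits I l) \<noteq> 1)"
  then have m: "m > 0" "exits I (int m) = {i1, i2}" "i1 > i2" and one: "\<forall>l>0. card (exits I l) \<noteq> 1"
    by blast+
  obtain r s where chains: "maximal_chain I m i1 r" "maximal_chain I m i2 s"
      "I = chain m i1 r \<union> chain m i2 s" "chain m i1 r \<inter> chain m i2 s = {}"
    using exits_pair_chains[OF assms(1) m(1,2)] m(3) by blast
  note general = general_second_order_op[OF assms(1,3,4) m one chains]
  show "(\<exists>r s :: nat. r \<ge> 1 \<and> s \<ge> 1 \<and> (r - 1) * m \<le> i1 \<and> (s - 1) * m \<le> i2 \<and>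
           I = chain m i1 r \<union> chain m i2 s \<and> chain m i1 r \<inter> chain m i2 s = {} \<and>
           ((\<exists>!S. S \<in> splittings I) \<longrightarrow>
             (let b1 = i1 - (r - 1) * m;
                  b2 = i2 - (s - 1) * m;
                  T = (\<lambda>\<alpha>1 \<alpha>2 \<alpha>3 \<alpha>4 f.
                         smult \<alpha>1 (monom 1 m * xD_minus i1 (xD_minus i2 f))
                         + degree0_op \<alpha>2 \<alpha>3 \<alpha>4 f)
              in (m = 1 \<longrightarrow> b2 = 0 \<and>
                    second_order_ops_preserving (monomial_space I)
                      = {\<lambda>f. T \<alpha>1 \<alpha>2 \<alpha>3 \<alpha>4 f + smult \<alpha>5 (pderiv (xD_minus b1 f))
                         | \<alpha>1 \<alpha>2 \<alpha>3 \<alpha>4 \<alpha>5. True}) \<and>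
                 (m = 2 \<and> {b2, b1} = {0, 1} \<longrightarrow>
                    second_order_ops_preserving (monomial_space I)
                      = {\<lambda>f. T \<alpha>1 \<alpha>2 \<alpha>3 \<alpha>4 f + smult \<alpha>5 (pderiv (pderiv f))
                         | \<alpha>1 \<alpha>2 \<alpha>3 \<alpha>4 \<alpha>5. True}) \<and>
                 (m \<noteq> 1 \<and> \<not> (m = 2 \<and> {b2, b1} = {0, 1}) \<longrightarrow>
                    second_order_ops_preserving (monomial_space I)
                      = {T \<alpha>1 \<alpha>2 \<alpha>3 \<alpha>4 | \<alpha>1 \<alpha>2 \<alpha>3 \<alpha>4. True}))))"
  proof (rule exI[of _ r], rule exI[of _ s], intro conjI impI)
    show "r \<ge> 1" "s \<ge> 1" "(r - 1) * m \<le> i1" "(s - 1) * m \<le> i2"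
      using chains(1,2) by (simp_all add: maximal_chain_def)
    show "I = chain m i1 r \<union> chain m i2 s" "chain m i1 r \<inter> chain m i2 s = {}"
      by (fact chains)+
    assume S: "\<exists>!S. S \<in> splittings I"
    show "let b1 = i1 - (r - 1) * m;
                  b2 = i2 - (s - 1) * m;
                  T = (\<lambda>\<alpha>1 \<alpha>2 \<alpha>3 \<alpha>4 f.
                         smult \<alpha>1 (monom 1 m * xD_minus i1 (xD_minus i2 f))
                         + degree0_op \<alpha>2 \<alpha>3 \<alpha>4 f)
              in (m = 1 \<longrightarrow> b2 = 0 \<and>
                    second_order_ops_preserving (monomial_space I)
                      = {\<lambda>f. T \<alpha>1 \<alpha>2 \<alpha>3 \<alpha>4 f + smult \<alpha>5 (pderiv (xD_minus b1 f))
                         | \<alpha>1 \<alpha>2 \<alpha>3 \<alpha>4 \<alpha>5. True}) \<and>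
                 (m = 2 \<and> {b2, b1} = {0, 1} \<longrightarrow>
                    second_order_ops_preserving (monomial_space I)
                      = {\<lambda>f. T \<alpha>1 \<alpha>2 \<alpha>3 \<alpha>4 f + smult \<alpha>5 (pderiv (pderiv f))
                         | \<alpha>1 \<alpha>2 \<alpha>3 \<alpha>4 \<alpha>5. True}) \<and>
                 (m \<noteq> 1 \<and> \<not> (m = 2 \<and> {b2, b1} = {0, 1}) \<longrightarrow>
                    second_order_ops_preserving (monomial_space I)
                      = {T \<alpha>1 \<alpha>2 \<alpha>3 \<alpha>4 | \<alpha>1 \<alpha>2 \<alpha>3 \<alpha>4. True})"
      unfolding Let_def
    proof (intro conjI impI, goal_cases)
      case 1
      then show ?case by (rule general(1)[OF S])
    next
      case 2
      then show ?case unfolding general(2)[OF S] by simp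
    next
      case 3
      \<comment> \<open>Here the condition on \<gamma> is vacuous, while m = 2 forces \<beta> =
        0.\<close>
      show ?case
        unfolding general(2)[OF S] Eq_TrueI[OF 3] using 3[THEN conjunct1] by simp
    next
      case 4
      \<comment> \<open>Outside both exceptional cases the conditions force \<beta> = \<gamma> =
        0.\<close>
      show ?case
        unfolding general(2)[OF S] Eq_FalseI[OF 4[THEN conjunct2]] using 4[THEN conjunct1] by simp
    qed
  qed
qed

end
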